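(* Every hereditarily Lindelöf hereditarily Baire topological space $X$ which hereditarily has a $\sigma$-discrete $\pi$-base has the property $({\rm B}_1^*={\rm B}_1)$, i.e. every ${\rm B}_1^*$-embedded subset of $X$ is ${\rm B}_1$-embedded in $X$.
   Context: A function $f:X\to\mathbb R$ on a topological space $X$ is Baire-one if it is a pointwise limit of a sequence of continuous real-valued functions on $X$; ${\rm B}_1(X)$ is the set of all Baire-one functions on $X$. A subset $E\subseteq X$ (with the subspace topology) is ${\rm B}_1$-embedded in $X$ if every $f\in{\rm B}_1(E)$ extends to some $g\in{\rm B}_1(X)$; it is ${\rm B}_1^*$-embedded in $X$ if every bounded $f\in{\rm B}_1(E)$ extends to some $g\in{\rm B}_1(X)$. A space is hereditarily Lindelöf if each of its subspaces is Lindelöf. A space is hereditarily Baire if each of its closed subspaces is a Baire space. A $\pi$-base of a space is a family of nonempty open sets such that every nonempty open set contains a member of the family. A family of sets is discrete if every point of the space has a neighbourhood meeting at most one member; it is $\sigma$-discrete if it is a countable union of discrete families. A space hereditarily has a $\sigma$-discrete $\pi$-base if every closed subspace of it has a $\sigma$-discrete $\pi$-base. *)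

theory Defs
  imports "HOL-Analysis.Analysis"
begin

text \<open>Functions on a space \<open>X\<close> are total functions on the carrier type; only their values on
  \<^term>\<open>topspace X\<close> are ever constrained.\<close>

definition Baire_one :: "'a topology \<Rightarrow> ('a \<Rightarrow> real) \<Rightarrow> bool" where
  "Baire_one X f \<longleftrightarrow>
     (\<exists>g :: nat \<Rightarrow> 'a \<Rightarrow> real. (\<forall>n. continuous_map X euclideanreal (g n)) \<and>
        (\<forall>x \<in> topspace X. (\<lambda>n. g n x) \<longlonglongrightarrow> f x))"

definition B1_embedded :: "'a topology \<Rightarrow> 'a set \<Rightarrow> bool" where
  "B1_embedded X E \<longleftrightarrow> E \<subseteq> topspace X \<and>
     (\<forall>f. Baire_one (subtopology X E) f \<longrightarrow>
        (\<exists>g. Baire_one X g \<and> (\<forall>x\<in>E. g x = f x)))"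

definition B1_star_embedded :: "'a topology \<Rightarrow> 'a set \<Rightarrow> bool" where
  "B1_star_embedded X E \<longleftrightarrow> E \<subseteq> topspace X \<and>
     (\<forall>f. Baire_one (subtopology X E) f \<and> bounded (f ` E) \<longrightarrow>
        (\<exists>g. Baire_one X g \<and> (\<forall>x\<in>E. g x = f x)))"

definition B1_star_eq_B1 :: "'a topology \<Rightarrow> bool" where
  "B1_star_eq_B1 X \<longleftrightarrow>
     (\<forall>E. E \<subseteq> topspace X \<and> B1_star_embedded X E \<longrightarrow> B1_embedded X E)"

definition Baire_space :: "'a topology \<Rightarrow> bool" where
  "Baire_space X \<longleftrightarrow>
     (\<forall>U :: nat \<Rightarrow> 'a set.
        (\<forall>n. openin X (U n) \<and> X closure_of (U n) = topspace X) \<longrightarrow>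
        X closure_of (topspace X \<inter> (\<Inter>n. U n)) = topspace X)"

text \<open>Unlike \<^const>\<open>hereditarily\<close>, which quantifies over all subspaces, this only
  quantifies over the closed ones.\<close>

definition closed_hereditarily :: "('a topology \<Rightarrow> bool) \<Rightarrow> 'a topology \<Rightarrow> bool" where
  "closed_hereditarily P X \<longleftrightarrow> (\<forall>F. closedin X F \<longrightarrow> P (subtopology X F))"

definition pi_base :: "'a topology \<Rightarrow> 'a set set \<Rightarrow> bool" where
  "pi_base X \<B> \<longleftrightarrow>
     (\<forall>B\<in>\<B>. openin X B \<and> B \<noteq> {}) \<and>
     (\<forall>U. openin X U \<and> U \<noteq> {} \<longrightarrow> (\<exists>B\<in>\<B>. B \<subseteq> U))"

definition discrete_family :: "'a topology \<Rightarrow> 'a set set \<Rightarrow> bool" where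
  "discrete_family X \<D> \<longleftrightarrow>
     (\<forall>x \<in> topspace X. \<exists>V. openin X V \<and> x \<in> V \<and>
        (\<forall>A\<in>\<D>. \<forall>B\<in>\<D>. A \<inter> V \<noteq> {} \<and> B \<inter> V \<noteq> {} \<longrightarrow> A = B))"

definition sigma_discrete_family :: "'a topology \<Rightarrow> 'a set set \<Rightarrow> bool" where
  "sigma_discrete_family X \<B> \<longleftrightarrow>
     (\<exists>\<D> :: nat \<Rightarrow> 'a set set. (\<forall>n. discrete_family X (\<D> n)) \<and> \<B> = (\<Union>n. \<D> n))"

definition has_sigma_discrete_pi_base :: "'a topology \<Rightarrow> bool" where
  "has_sigma_discrete_pi_base X \<longleftrightarrow> (\<exists>\<B>. pi_base X \<B> \<and> sigma_discrete_family X \<B>)"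

end

theory Submission
  imports Defs
begin

text \<open>
  The obstacle to extending an unbounded \<open>f\<close> is controlling its growth. Let \<open>arctan \<circ> f\<close> extend to a
  Baire-one \<open>g\<close> on \<open>X\<close>. If \<open>X\<close> is covered by countably many zero sets on each of which \<open>f\<close> is bounded, then
  \<open>\<bar>f\<bar>\<close> is dominated on \<open>E\<close> by a Baire-one function \<open>b\<close> on \<open>X\<close>, and the tangent of \<open>g\<close> clipped to
  \<open>[- arctan b, arctan b]\<close> is an extension of \<open>f\<close>. Otherwise, removing all open sets which have such a
  countable cover leaves a nonempty closed \<open>F\<close> such that \<open>f\<close> is unbounded on every zero set containing
  a nonempty relatively open part of \<open>F\<close>. In each zero hull of a member of a countable \<open>\<pi>\<close>-base of \<open>F\<close> pick two
  points of \<open>E\<close>, with the values of \<open>\<bar>f\<bar>\<close> at all chosen points at mutual distance at least 1. A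
  suitable bounded continuous function of \<open>\<bar>f\<bar>\<close> is 1 at the first and 0 at the second
  point of each pair, and by the Baire property of \<open>F\<close> it has no Baire-one extension. No separation
  axiom is available, so closures have to be taken with respect to zero sets.
\<close>

section \<open>Zero hulls in hereditarily Lindelof spaces\<close>

text \<open>For \<open>V\<close> inside the space this is the closure of \<open>V\<close> in the
  topology generated by the cozero sets of \<open>X\<close>.\<close>

definition zero_hull :: "'a topology \<Rightarrow> 'a set \<Rightarrow> 'a set" where
  "zero_hull X V = {x \<in> topspace X. \<forall>z. continuous_map X euclideanreal z \<and> (\<forall>v\<in>V. z v = 0) \<longrightarrow> z x = 0}"

lemma subset_zero_hull: "V \<subseteq> topspace X \<Longrightarrow> V \<subseteq> zero_hull X V"
  by (auto simp: zero_hull_def)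

lemma zero_hull_mono: "V \<subseteq> W \<Longrightarrow> zero_hull X V \<subseteq> zero_hull X W"
  unfolding zero_hull_def by blast

text \<open>The positive part of \<open>h - c\<close> is continuous and vanishes on
  \<open>V\<close>, hence on the hull.\<close>

lemma zero_hull_le:
  assumes "continuous_map X euclideanreal h" "\<And>v. v \<in> V \<Longrightarrow> h v \<le> c" "x \<in> zero_hull X V"
  shows "h x \<le> c"
proof -
  have "continuous_map X euclideanreal (\<lambda>x. max (h x - c) 0)"
    by (intro continuous_map_real_max continuous_map_diff assms(1)) auto
  then have "max (h x - c) 0 = 0"
    using assms(2,3) by (fastforce simp: zero_hull_def)
  then show ?thesis by simp
qed

lemma zero_hull_ge:
  assumes "continuous_map X euclideanreal h" "\<And>v. v \<in> V \<Longrightarrow> c \<le> h v" "x \<in> zero_hull X V"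
  shows "c \<le> h x"
  using zero_hull_le[of X "\<lambda>x. - h x" V "- c" x] assms by (auto intro: continuous_map_minus)

text \<open>The complement of the hull is a union of cozero sets and is Lindelof as a subspace, so
  countably many of them cover it.\<close>

lemma zero_hull_cozero_cover:
  assumes "hereditarily Lindelof_space X"
  obtains z :: "nat \<Rightarrow> 'a \<Rightarrow> real"
  where "\<And>j. continuous_map X euclideanreal (z j)"
    and "\<And>j x. x \<in> zero_hull X V \<Longrightarrow> z j x = 0"
    and "\<And>x. x \<in> topspace X - zero_hull X V \<Longrightarrow> \<exists>j. z j x \<noteq> 0"
proof -
  define C where "C = {z. continuous_map X euclideanreal z \<and> (\<forall>v\<in>V. z v = 0)}"
  define coz where "coz = (\<lambda>z::'a\<Rightarrow>real. {x \<in> topspace X. z x \<noteq> 0})"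
  define S where "S = topspace X - zero_hull X V"
  have S: "S = \<Union> (coz ` C)"
    by (auto simp: S_def C_def coz_def zero_hull_def)
  have "openin X (coz z)" if "z \<in> C" for z
    using openin_continuous_map_preimage[of X euclideanreal z "- {0}"] that
    by (simp add: C_def coz_def open_Compl flip: Compl_eq)
  then have "\<forall>U \<in> coz ` C. openin X U"
    by blast
  moreover have "S \<subseteq> topspace X"
    by (auto simp: S_def)
  moreover have "Lindelof_space (subtopology X S)"
    using assms \<open>S \<subseteq> topspace X\<close> unfolding hereditarily_def by blast
  ultimately obtain \<V> where \<V>: "countable \<V>" "\<V> \<subseteq> coz ` C" "S \<subseteq> \<Union>\<V>"
    using S Lindelof_space_subtopology_subset[of S X] by (metis order_refl)
  obtain D where D: "countable D" "D \<subseteq> C" "\<V> = coz ` D"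
    using \<V>(1,2) by (meson countable_subset_image)
  have zC: "(\<lambda>_. 0) \<in> C"
    by (auto simp: C_def)
  \<comment> \<open>The zero function keeps the enumerated set nonempty even if \<open>D\<close> is
    empty.\<close>
  define z where "z = from_nat_into (insert (\<lambda>_. 0) D)"
  have r: "range z = insert (\<lambda>_. 0) D"
    unfolding z_def using D(1) by (intro range_from_nat_into) auto
  have zj: "z j \<in> C" for j
    using r zC D(2) rangeI[of z j] by auto
  show thesis
  proof
    show "continuous_map X euclideanreal (z j)" for j
      using zj by (auto simp: C_def)
    show "z j x = 0" if "x \<in> zero_hull X V" for j x
      using zj[of j] that by (auto simp: C_def zero_hull_def)
    show "\<exists>j. z j x \<noteq> 0" if x: "x \<in> topspace X - zero_hull X V" for x
    proof -
      obtain y where "y \<in> D" "y x \<noteq> 0"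
        using x \<V>(3) unfolding D(3) S_def coz_def by blast
      then show ?thesis
        using r by (metis insertCI rangeE)
    qed
  qed
qed

text \<open>Approximants that vanish on the hull at every stage, not only in the limit, are what
  makes the sums in \<open>Baire_one_dominating\<close> break off.\<close>

lemma zero_hull_indicator:
  assumes "hereditarily Lindelof_space X"
  shows "\<exists>u :: nat \<Rightarrow> 'a \<Rightarrow> real. (\<forall>k. continuous_map X euclideanreal (u k)) \<and>
           (\<forall>k. \<forall>x \<in> zero_hull X V. u k x = 0) \<and>
           (\<forall>x \<in> topspace X - zero_hull X V. (\<lambda>k. u k x) \<longlonglongrightarrow> 1)"
proof -
  obtain z :: "nat \<Rightarrow> 'a \<Rightarrow> real"
    where z: "\<And>j. continuous_map X euclideanreal (z j)"
      "\<And>j x. x \<in> zero_hull X V \<Longrightarrow> z j x = 0"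
      "\<And>x. x \<in> topspace X - zero_hull X V \<Longrightarrow> \<exists>j. z j x \<noteq> 0"
    using zero_hull_cozero_cover[OF assms] by metis
  \<comment> \<open>If \<open>z j x \<noteq> 0\<close>, factor \<open>j\<close> is exactly 0 once
    \<open>k > j\<close> and \<open>k \<ge> 1 / \<bar>z j x\<bar>\<close>, so \<open>u k x\<close>
    is eventually 1. On the hull all factors are 1.\<close>
  define u where "u = (\<lambda>k x. 1 - (\<Prod>j<k. 1 - min 1 (real k * \<bar>z j x\<bar>)))"
  have "continuous_map X euclideanreal (u k)" for k
    unfolding u_def
    by (intro continuous_map_diff continuous_map_prod continuous_map_real_min
        continuous_map_real_mult continuous_map_real_abs z) auto
  moreover have "u k x = 0" if "x \<in> zero_hull X V" for k x
    using z(2)[OF that] by (simp add: u_def)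
  moreover have "(\<lambda>k. u k x) \<longlonglongrightarrow> 1" if x: "x \<in> topspace X - zero_hull X V" for x
  proof -
    obtain j where j: "z j x \<noteq> 0"
      using z(3)[OF x] by blast
    obtain N :: nat where N: "1 / \<bar>z j x\<bar> \<le> N"
      using real_arch_simple by blast
    have "u k x = 1" if "k \<ge> max (Suc j) N" for k
    proof -
      have "1 / \<bar>z j x\<bar> \<le> k"
        using N that by linarith
      then have "1 \<le> real k * \<bar>z j x\<bar>"
        using j by (simp add: field_simps)
      moreover have "j < k"
        using that by simp
      ultimately show ?thesis
        by (auto simp: u_def intro!: bexI[of _ j])
    qed
    then show ?thesis
      by (intro tendsto_eventually eventually_sequentiallyI)
  qed
  ultimately show ?thesis
    by blast
qed

section \<open>Baire-one functions: domination and extension\<close>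

lemma Baire_one_compose:
  assumes "Baire_one X f" "continuous_on UNIV \<psi>"
  shows "Baire_one X (\<lambda>x. \<psi> (f x))"
proof -
  obtain g where g: "\<And>n. continuous_map X euclideanreal (g n)"
    "\<And>x. x \<in> topspace X \<Longrightarrow> (\<lambda>n. g n x) \<longlonglongrightarrow> f x"
    using assms(1) by (auto simp: Baire_one_def)
  have "continuous_map X euclideanreal (\<lambda>x. \<psi> (g n x))" for n
    using continuous_map_compose[OF g(1), of euclideanreal \<psi> n] assms(2) by (simp add: o_def)
  moreover have "(\<lambda>n. \<psi> (g n x)) \<longlonglongrightarrow> \<psi> (f x)" if "x \<in> topspace X" for x
    using continuous_on_tendsto_compose[OF assms(2) g(2)[OF that]] by simp
  ultimately show ?thesis
    unfolding Baire_one_def by (intro exI[of _ "\<lambda>n x. \<psi> (g n x)"]) auto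
qed

text \<open>Summing the \<open>M n\<close> up to the first index whose hull contains
  \<open>x\<close> gives a suitable value: by nonnegativity the sum is at least its last
  term.\<close>

lemma Baire_one_dominating:
  fixes M :: "nat \<Rightarrow> real"
  assumes X: "hereditarily Lindelof_space X"
    and cover: "topspace X \<subseteq> (\<Union>n. zero_hull X (V n))"
    and M: "\<And>n. 0 \<le> M n"
  obtains b where "Baire_one X b"
    and "\<And>x. x \<in> topspace X \<Longrightarrow> \<exists>n. x \<in> zero_hull X (V n) \<and> M n \<le> b x"
proof -
  let ?Z = "\<lambda>n. zero_hull X (V n)"
  obtain u :: "nat \<Rightarrow> nat \<Rightarrow> 'a \<Rightarrow> real"
    where u: "\<And>i k. continuous_map X euclideanreal (u i k)"
      "\<And>i k x. x \<in> ?Z i \<Longrightarrow> u i k x = 0"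
      "\<And>i x. x \<in> topspace X - ?Z i \<Longrightarrow> (\<lambda>k. u i k x) \<longlonglongrightarrow> 1"
    using zero_hull_indicator[OF X, of "V _"] by metis
  \<comment> \<open>The product tends to 1 if \<open>x\<close> avoids the first \<open>n\<close>
    hulls, and is 0 for every \<open>k\<close> otherwise. So only the terms with
    \<open>n \<le> m x\<close> survive.\<close>
  define \<beta> where "\<beta> = (\<lambda>k x. \<Sum>n<k. M n * (\<Prod>i<n. u i k x))"
  define m where "m = (\<lambda>x. LEAST n. x \<in> ?Z n)"
  define b where "b = (\<lambda>x. \<Sum>n\<le>m x. M n)"
  have m: "x \<in> ?Z (m x)" if "x \<in> topspace X" for x
    unfolding m_def by (rule LeastI_ex) (use that cover in auto)
  have "continuous_map X euclideanreal (\<beta> k)" for k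
    unfolding \<beta>_def
    by (intro continuous_map_sum continuous_map_real_mult continuous_map_prod u) auto
  moreover have "(\<lambda>k. \<beta> k x) \<longlonglongrightarrow> b x" if x: "x \<in> topspace X" for x
  proof -
    have "(\<lambda>k. u i k x) \<longlonglongrightarrow> 1" if "i < m x" for i
      using u(3)[of x i] x not_less_Least[of i "\<lambda>n. x \<in> ?Z n"] that by (auto simp: m_def)
    then have "(\<lambda>k. \<Sum>n\<le>m x. M n * (\<Prod>i<n. u i k x)) \<longlonglongrightarrow> (\<Sum>n\<le>m x. M n * (\<Prod>i<n. 1))"
      by (intro tendsto_sum tendsto_mult tendsto_const tendsto_prod) auto
    then have lim: "(\<lambda>k. \<Sum>n\<le>m x. M n * (\<Prod>i<n. u i k x)) \<longlonglongrightarrow> b x"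
      by (simp add: b_def)
    have eq: "\<beta> k x = (\<Sum>n\<le>m x. M n * (\<Prod>i<n. u i k x))" if "k \<ge> Suc (m x)" for k
      unfolding \<beta>_def
    proof (rule sum.mono_neutral_right)
      show "\<forall>n\<in>{..<k} - {..m x}. M n * (\<Prod>i<n. u i k x) = 0"
        using u(2)[OF m[OF x], of k] by (auto intro!: bexI[of _ "m x"])
    qed (use that in auto)
    show ?thesis
      by (rule Lim_transform_eventually[OF lim eventually_sequentiallyI[of "Suc (m x)"]])
        (simp add: eq)
  qed
  ultimately have "Baire_one X b"
    by (auto simp: Baire_one_def)
  moreover have "M (m x) \<le> b x" for x
    unfolding b_def using M by (intro member_le_sum) auto
  ultimately show thesis
    using m that by blast
qed

text \<open>Off \<open>E\<close> the values of \<open>g\<close> may leave the range of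
  \<open>arctan\<close>. Clipping by \<open>arctan b\<close> brings them back without changing
  \<open>g\<close> on \<open>E\<close>.\<close>

lemma Baire_one_extension_of_dominated:
  assumes g: "Baire_one X g" "\<And>x. x \<in> E \<Longrightarrow> g x = arctan (f x)"
    and b: "Baire_one X b" "\<And>x. x \<in> E \<Longrightarrow> \<bar>f x\<bar> \<le> b x"
  shows "\<exists>h. Baire_one X h \<and> (\<forall>x\<in>E. h x = f x)"
proof -
  \<comment> \<open>For \<open>s < 0\<close>, which may occur among the \<open>B n x\<close>, the
    two bounds are reversed and the value is \<open>- arctan s\<close>, still strictly between
    \<open>- (pi/2)\<close> and \<open>pi/2\<close>.\<close>
  define clip where "clip = (\<lambda>s t :: real. max (- arctan s) (min (arctan s) t))"
  have clip_bounds: "- (pi/2) < clip s t \<and> clip s t < pi/2" for s t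
    using arctan_bounded[of s] by (auto simp: clip_def)
  obtain G where G: "\<And>n. continuous_map X euclideanreal (G n)"
    "\<And>x. x \<in> topspace X \<Longrightarrow> (\<lambda>n. G n x) \<longlonglongrightarrow> g x"
    using g(1) by (auto simp: Baire_one_def)
  obtain B where B: "\<And>n. continuous_map X euclideanreal (B n)"
    "\<And>x. x \<in> topspace X \<Longrightarrow> (\<lambda>n. B n x) \<longlonglongrightarrow> b x"
    using b(1) by (auto simp: Baire_one_def)
  have atan: "continuous_map X euclideanreal (\<lambda>x. arctan (B n x))" for n
    using continuous_map_compose[OF B(1), of euclideanreal arctan n]
    by (simp add: o_def continuous_on_arctan)
  have "continuous_map X euclideanreal (\<lambda>x. clip (B n x) (G n x))" for n
    unfolding clip_def
    by (intro continuous_map_real_max continuous_map_real_min continuous_map_minus atan G)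
  then have "continuous_map X (top_of_set {- (pi/2)<..<pi/2}) (\<lambda>x. clip (B n x) (G n x))" for n
    using clip_bounds by (auto simp: continuous_map_in_subtopology)
  moreover have "continuous_on {- (pi/2)<..<pi/2} tan"
    by (intro continuous_on_tan continuous_on_id) (use cos_gt_zero_pi in fastforce)
  ultimately have "continuous_map X euclideanreal (\<lambda>x. tan (clip (B n x) (G n x)))" for n
    using continuous_map_compose[of X "top_of_set {- (pi/2)<..<pi/2}" _ euclideanreal tan]
    by (simp add: o_def)
  moreover have "(\<lambda>n. tan (clip (B n x) (G n x))) \<longlonglongrightarrow> tan (clip (b x) (g x))"
    if "x \<in> topspace X" for x
  proof (rule isCont_tendsto_compose[OF isCont_tan])
    show "(\<lambda>n. clip (B n x) (G n x)) \<longlonglongrightarrow> clip (b x) (g x)"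
      unfolding clip_def using G(2)[OF that] B(2)[OF that] by (intro tendsto_intros)
    show "cos (clip (b x) (g x)) \<noteq> 0"
      using clip_bounds[of "b x" "g x"] cos_gt_zero_pi by fastforce
  qed
  ultimately have "Baire_one X (\<lambda>x. tan (clip (b x) (g x)))"
    unfolding Baire_one_def by (intro exI[of _ "\<lambda>n x. tan (clip (B n x) (G n x))"]) auto
  moreover have "tan (clip (b x) (g x)) = f x" if "x \<in> E" for x
  proof -
    have "arctan (f x) \<le> arctan (b x)" "arctan (- b x) \<le> arctan (f x)"
      using b(2)[OF that] by (auto simp: arctan_le_iff)
    then have "clip (b x) (g x) = arctan (f x)"
      using g(2)[OF that] by (auto simp: clip_def arctan_minus)
    then show ?thesis
      by (simp add: tan_arctan)
  qed
  ultimately show ?thesis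
    by blast
qed

section \<open>Countable pi-bases\<close>

text \<open>Open sets meeting at most one member cover the space. In a countable subcover each
  member meets some set, and no set serves two members.\<close>

lemma countable_discrete_family:
  assumes "Lindelof_space X" "discrete_family X \<D>" "\<And>D. D \<in> \<D> \<Longrightarrow> D \<noteq> {} \<and> D \<subseteq> topspace X"
  shows "countable \<D>"
proof -
  define \<W> where "\<W> = {V. openin X V \<and> (\<forall>A\<in>\<D>. \<forall>B\<in>\<D>. A \<inter> V \<noteq> {} \<and> B \<inter> V \<noteq> {} \<longrightarrow> A = B)}"
  have "topspace X \<subseteq> \<Union>\<W>"
  proof
    fix x assume "x \<in> topspace X"
    then obtain V where "x \<in> V" "V \<in> \<W>"
      using assms(2) unfolding discrete_family_def \<W>_def mem_Collect_eq by metis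
    then show "x \<in> \<Union>\<W>"
      by blast
  qed
  then have "\<Union>\<W> = topspace X"
    by (auto simp: \<W>_def dest: openin_subset)
  moreover have "\<forall>V\<in>\<W>. openin X V"
    by (simp add: \<W>_def)
  ultimately obtain \<V> where \<V>: "countable \<V>" "\<V> \<subseteq> \<W>" "\<Union>\<V> = topspace X"
    using assms(1) unfolding Lindelof_space_def by meson
  have "\<exists>V\<in>\<V>. D \<inter> V \<noteq> {}" if "D \<in> \<D>" for D
    using assms(3)[OF that] \<V>(3) by blast
  then obtain c where c: "\<And>D. D \<in> \<D> \<Longrightarrow> c D \<in> \<V> \<and> D \<inter> c D \<noteq> {}"
    by metis
  have "inj_on c \<D>"
  proof (rule inj_onI)
    fix A B assume AB: "A \<in> \<D>" "B \<in> \<D>" "c A = c B"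
    then have "c A \<in> \<W>" "A \<inter> c A \<noteq> {}" "B \<inter> c A \<noteq> {}"
      using c[of A] c[of B] \<V>(2) by auto
    then show "A = B"
      using AB unfolding \<W>_def by blast
  qed
  moreover have "countable (c ` \<D>)"
    by (rule countable_subset[OF _ \<V>(1)]) (use c in auto)
  ultimately show ?thesis
    by (rule countable_image_inj_on[rotated])
qed

lemma countable_pi_base:
  assumes "Lindelof_space X" "has_sigma_discrete_pi_base X"
  obtains \<B> where "countable \<B>" "pi_base X \<B>"
proof -
  obtain \<B> \<D> where \<B>: "pi_base X \<B>" "\<And>n::nat. discrete_family X (\<D> n)" "\<B> = (\<Union>n. \<D> n)"
    using assms(2) unfolding has_sigma_discrete_pi_base_def sigma_discrete_family_def by blast
  have "countable (\<D> n)" for n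
  proof (rule countable_discrete_family[OF assms(1) \<B>(2)])
    fix D assume "D \<in> \<D> n"
    then have "openin X D \<and> D \<noteq> {}"
      using \<B>(1,3) unfolding pi_base_def by blast
    then show "D \<noteq> {} \<and> D \<subseteq> topspace X"
      using openin_subset by blast
  qed
  then show thesis
    using that[of \<B>] \<B>(1,3) by simp
qed

section \<open>Baire category and oscillation\<close>

text \<open>Otherwise the complements of the \<open>Z n\<close> would be dense open sets with empty
  intersection.\<close>

lemma Baire_space_closed_cover:
  fixes Z :: "nat \<Rightarrow> 'a set"
  assumes "Baire_space X" "topspace X \<noteq> {}" "\<And>n. closedin X (Z n)" "topspace X \<subseteq> (\<Union>n. Z n)"
  obtains n V where "openin X V" "V \<noteq> {}" "V \<subseteq> Z n"
proof -
  define U where "U = (\<lambda>n. topspace X - Z n)"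
  have U: "openin X (U n)" for n
    using assms(3) by (auto simp: U_def)
  have "topspace X \<inter> (\<Inter>n. U n) = {}"
    using assms(4) by (auto simp: U_def)
  then obtain n where n: "X closure_of (U n) \<noteq> topspace X"
    using assms(1,2) U unfolding Baire_space_def by (metis closure_of_empty)
  define V where "V = topspace X - X closure_of (U n)"
  have "openin X V" "V \<noteq> {}"
    using n closure_of_subset_topspace[of X "U n"] by (auto simp: V_def)
  moreover have "V \<subseteq> Z n"
    using closure_of_subset[of "U n" X] by (auto simp: V_def U_def)
  ultimately show thesis
    using that by blast
qed

text \<open>By category, a whole tail of continuous approximants satisfies one of the two bounds on
  some \<open>V\<close>. Such bounds pass to the hull of \<open>V\<close>, even outside
  \<open>F\<close>, and then to the limit. Hence \<open>H\<close> cannot take both values 0 and 1 on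
  that hull.\<close>

lemma Baire_one_hull_oscillation:
  assumes F: "closedin X F" "F \<noteq> {}" "Baire_space (subtopology X F)"
    and H: "Baire_one X H"
  obtains V where "openin (subtopology X F) V" "V \<noteq> {}"
    and "(\<forall>x \<in> zero_hull X V. H x \<le> 2/3) \<or> (\<forall>x \<in> zero_hull X V. 1/3 \<le> H x)"
proof -
  obtain h where h: "\<And>n. continuous_map X euclideanreal (h n)"
    "\<And>x. x \<in> topspace X \<Longrightarrow> (\<lambda>n. h n x) \<longlonglongrightarrow> H x"
    using H by (auto simp: Baire_one_def)
  define L where "L = (\<lambda>m. {x \<in> F. \<forall>n\<ge>m. h n x \<le> 2/3})"
  define R where "R = (\<lambda>m. {x \<in> F. \<forall>n\<ge>m. 1/3 \<le> h n x})"
  \<comment> \<open>Interleaving turns the two families into a single sequence of closed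
    sets.\<close>
  define Z where "Z = (\<lambda>i. if even i then L (i div 2) else R (i div 2))"
  have FX: "F \<subseteq> topspace X"
    using F(1) by (rule closedin_subset)
  have tF: "topspace (subtopology X F) = F"
    using FX by auto
  have hF: "continuous_map (subtopology X F) euclideanreal (h n)" for n
    using h(1) by (rule continuous_map_from_subtopology)
  have "closedin (subtopology X F) (L m)" for m
  proof -
    have "L m = (\<Inter>n\<in>{m..}. {x \<in> topspace (subtopology X F). h n x \<in> {..2/3}})"
      using tF by (auto simp: L_def)
    also have "closedin (subtopology X F) \<dots>"
      by (intro closedin_INT closedin_continuous_map_preimage[OF hF])
        (simp_all flip: closed_closedin)
    finally show ?thesis .
  qed
  moreover have "closedin (subtopology X F) (R m)" for m
  proof -
    have "R m = (\<Inter>n\<in>{m..}. {x \<in> topspace (subtopology X F). h n x \<in> {1/3..}})"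
      using tF by (auto simp: R_def)
    also have "closedin (subtopology X F) \<dots>"
      by (intro closedin_INT closedin_continuous_map_preimage[OF hF])
        (simp_all flip: closed_closedin)
    finally show ?thesis .
  qed
  ultimately have cl: "closedin (subtopology X F) (Z i)" for i
    by (simp add: Z_def)
  \<comment> \<open>The overlap of the two ranges gives a strict inequality for \<open>H x\<close>
    in either case, which the approximants eventually inherit.\<close>
  have cover: "x \<in> (\<Union>i. Z i)" if x: "x \<in> F" for x
  proof (cases "H x < 2/3")
    case True
    then have "eventually (\<lambda>n. h n x < 2/3) sequentially"
      using h(2) x FX by (intro order_tendstoD(2)[of _ "H x"]) auto
    then obtain m where "x \<in> L m"
      using x by (auto simp: L_def eventually_sequentially intro: less_imp_le)
    then have "x \<in> Z (2 * m)"
      by (simp add: Z_def)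
    then show ?thesis by blast
  next
    case False
    then have "eventually (\<lambda>n. 1/3 < h n x) sequentially"
      using h(2) x FX by (intro order_tendstoD(1)[of _ "H x"]) auto
    then obtain m where "x \<in> R m"
      using x by (auto simp: R_def eventually_sequentially intro: less_imp_le)
    then have "x \<in> Z (2 * m + 1)"
      by (simp add: Z_def)
    then show ?thesis by blast
  qed
  obtain i V where V: "openin (subtopology X F) V" "V \<noteq> {}" "V \<subseteq> Z i"
  proof (rule Baire_space_closed_cover[OF F(3) _ cl])
    show "topspace (subtopology X F) \<noteq> {}"
      unfolding tF by (rule F(2))
    show "topspace (subtopology X F) \<subseteq> (\<Union>i. Z i)"
      unfolding tF by (rule subsetI) (rule cover)
  qed
  have le: "H x \<le> 2/3" if "V \<subseteq> L m" "x \<in> zero_hull X V" for m x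
  proof (rule LIMSEQ_le_const2)
    show "(\<lambda>n. h n x) \<longlonglongrightarrow> H x"
      using that(2) h(2) by (simp add: zero_hull_def)
    have "h n x \<le> 2/3" if "n \<ge> m" for n
      by (rule zero_hull_le[OF h(1) _ \<open>x \<in> zero_hull X V\<close>])
        (use that \<open>V \<subseteq> L m\<close> in \<open>auto simp: L_def\<close>)
    then show "\<exists>N. \<forall>n\<ge>N. h n x \<le> 2/3" by blast
  qed
  have ge: "1/3 \<le> H x" if "V \<subseteq> R m" "x \<in> zero_hull X V" for m x
  proof (rule LIMSEQ_le_const)
    show "(\<lambda>n. h n x) \<longlonglongrightarrow> H x"
      using that(2) h(2) by (simp add: zero_hull_def)
    have "1/3 \<le> h n x" if "n \<ge> m" for n
      by (rule zero_hull_ge[OF h(1) _ \<open>x \<in> zero_hull X V\<close>])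
        (use that \<open>V \<subseteq> R m\<close> in \<open>auto simp: R_def\<close>)
    then show "\<exists>N. \<forall>n\<ge>N. 1/3 \<le> h n x" by blast
  qed
  have "V \<subseteq> L (i div 2) \<or> V \<subseteq> R (i div 2)"
    using V(3) by (auto simp: Z_def split: if_splits)
  then show thesis
    using that[OF V(1,2)] le[of "i div 2"] ge[of "i div 2"] by blast
qed

section \<open>A bounded function without Baire-one extension\<close>

lemma separated_choice:
  fixes f :: "'a \<Rightarrow> real"
  assumes "\<And>n::nat. \<not> bounded (f ` S n)"
  obtains e where "\<And>n. e n \<in> S n" "\<And>m n. m < n \<Longrightarrow> \<bar>f (e m)\<bar> + 1 \<le> \<bar>f (e n)\<bar>"
proof -
  have large: "\<exists>x \<in> S n. c \<le> \<bar>f x\<bar>" for n c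
    using assms[of n] unfolding bounded_iff by (metis imageE nle_le real_norm_def)
  obtain e where e: "\<And>n. e n \<in> S n" "\<And>n. \<bar>f (e n)\<bar> + 1 \<le> \<bar>f (e (Suc n))\<bar>"
    using dependent_nat_choice[of "\<lambda>n x. x \<in> S n" "\<lambda>n x y. \<bar>f x\<bar> + 1 \<le> \<bar>f y\<bar>"] large by metis
  have "\<bar>f (e m)\<bar> + 1 \<le> \<bar>f (e n)\<bar>" if "m < n" for m n
    using that
  proof (induction n rule: less_Suc_induct)
    case (1 n)
    then show ?case by (rule e(2))
  qed linarith
  then show thesis
    using e(1) that by blast
qed

text \<open>If \<open>f\<close> were unbounded on every such hull, a bounded function of
  \<open>f\<close> would oscillate by 1 on all of them. Countability of \<open>\<B>\<close> lets one
  sequence of points serve all its members.\<close>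

lemma bounded_hull_of_relatively_open:
  assumes E: "B1_star_embedded X E" and f: "Baire_one (subtopology X E) f"
    and F: "closedin X F" "F \<noteq> {}" "Baire_space (subtopology X F)"
    and \<B>: "countable \<B>" "pi_base (subtopology X F) \<B>"
  obtains B where "openin (subtopology X F) B" "B \<noteq> {}" "bounded (f ` (E \<inter> zero_hull X B))"
proof (rule ccontr)
  assume "\<not> thesis"
  then have unb: "\<not> bounded (f ` (E \<inter> zero_hull X B))" if "B \<in> \<B>" for B
    using that \<B>(2) \<open>\<And>B. openin (subtopology X F) B \<Longrightarrow> B \<noteq> {} \<Longrightarrow> bounded (f ` (E \<inter> zero_hull X B)) \<Longrightarrow> thesis\<close>
    by (auto simp: pi_base_def)
  have "\<B> \<noteq> {}"
    using \<B>(2) F(1,2) unfolding pi_base_def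
    by (metis closedin_subset empty_iff openin_topspace topspace_subtopology_subset)
  define v where "v = from_nat_into \<B>"
  have v: "v n \<in> \<B>" for n
    using \<open>\<B> \<noteq> {}\<close> by (simp add: v_def from_nat_into)
  have range_v: "range v = \<B>"
    unfolding v_def using \<open>\<B> \<noteq> {}\<close> \<B>(1) by (rule range_from_nat_into)
  \<comment> \<open>Index \<open>n div 2\<close> puts both \<open>e (2 * k)\<close> and
    \<open>e (2 * k + 1)\<close> into the hull of \<open>v k\<close>.\<close>
  obtain e where e: "\<And>n. e n \<in> E \<inter> zero_hull X (v (n div 2))"
    "\<And>m n. m < n \<Longrightarrow> \<bar>f (e m)\<bar> + 1 \<le> \<bar>f (e n)\<bar>"
    using separated_choice[of f "\<lambda>n. E \<inter> zero_hull X (v (n div 2))"] unb v by blast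
  define S where "S = range (\<lambda>k. \<bar>f (e (2 * k + 1))\<bar>)"
  \<comment> \<open>This vanishes at the odd points. At the even ones the distance to
    \<open>S\<close> is at least 1, so the cap gives exactly 1 and also boundedness.\<close>
  define \<psi> where "\<psi> = (\<lambda>t. min 1 (infdist \<bar>t\<bar> S))"
  have "continuous_on UNIV \<psi>"
    unfolding \<psi>_def by (intro continuous_intros)
  then have "Baire_one (subtopology X E) (\<lambda>x. \<psi> (f x))"
    by (rule Baire_one_compose[OF f])
  moreover have "bounded ((\<lambda>x. \<psi> (f x)) ` E)"
    unfolding bounded_iff by (rule exI[of _ 1]) (auto simp: \<psi>_def infdist_nonneg)
  ultimately obtain H where H: "Baire_one X H" "\<And>x. x \<in> E \<Longrightarrow> H x = \<psi> (f x)"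
    using E unfolding B1_star_embedded_def by blast
  have H0: "H (e (2 * k + 1)) = 0" for k
    using H(2) e(1) by (auto simp: \<psi>_def S_def)
  have "S \<noteq> {}"
    by (simp add: S_def)
  have H1: "H (e (2 * k)) = 1" for k
  proof -
    have "1 \<le> infdist \<bar>f (e (2 * k))\<bar> S"
      unfolding infdist_notempty[OF \<open>S \<noteq> {}\<close>]
    proof (rule cINF_greatest[OF \<open>S \<noteq> {}\<close>])
      fix s assume "s \<in> S"
      then obtain j where j: "s = \<bar>f (e (2 * j + 1))\<bar>"
        by (auto simp: S_def)
      have "2 * k < 2 * j + 1 \<or> 2 * j + 1 < 2 * k"
        by presburger
      then show "1 \<le> dist \<bar>f (e (2 * k))\<bar> s"
        using e(2)[of "2 * k" "2 * j + 1"] e(2)[of "2 * j + 1" "2 * k"] j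
        by (auto simp: dist_real_def)
    qed
    then show ?thesis
      using H(2) e(1) by (simp add: \<psi>_def)
  qed
  obtain V where V: "openin (subtopology X F) V" "V \<noteq> {}"
    "(\<forall>x \<in> zero_hull X V. H x \<le> 2/3) \<or> (\<forall>x \<in> zero_hull X V. 1/3 \<le> H x)"
    using Baire_one_hull_oscillation[OF F H(1)] by blast
  \<comment> \<open>The pair chosen for \<open>v k\<close> lies in the hull of \<open>V\<close> by
    monotonicity, so \<open>H\<close> takes both 0 and 1 there.\<close>
  obtain k where "v k \<subseteq> V"
    using \<B>(2) V(1,2) range_v unfolding pi_base_def by blast
  then have "e (2 * k) \<in> zero_hull X V" "e (2 * k + 1) \<in> zero_hull X V"
    using e(1)[of "2 * k"] e(1)[of "2 * k + 1"] zero_hull_mono[of "v k" V X] by auto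
  then show False
    using V(3) H0[of k] H1[of k] by force
qed

section \<open>Exhaustion by countably covered open sets\<close>

theorem corollary2p5:
  fixes X :: "'a topology"
  assumes "hereditarily Lindelof_space X"
    and "closed_hereditarily Baire_space X"
    and "closed_hereditarily has_sigma_discrete_pi_base X"
  shows "B1_star_eq_B1 X"
  unfolding B1_star_eq_B1_def B1_embedded_def
proof (intro allI impI conjI; elim conjE)
  fix E f
  assume EX: "E \<subseteq> topspace X" and E: "B1_star_embedded X E"
    and f: "Baire_one (subtopology X E) f"
  define good where "good = {V. V \<subseteq> topspace X \<and> bounded (f ` (E \<inter> zero_hull X V))}"
  define \<W> where "\<W> = {W. openin X W \<and> (\<exists>\<V>. countable \<V> \<and> \<V> \<subseteq> good \<and> W \<subseteq> \<Union>\<V>)}"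
  have "openin X (\<Union>\<W>)"
    by (rule openin_Union) (simp add: \<W>_def)
  \<comment> \<open>Countably many members of \<open>\<W>\<close> suffice for its union, which
    therefore has a countable cover by good sets itself.\<close>
  have "Lindelof_space (subtopology X (\<Union>\<W>))"
    using assms(1) openin_subset[OF \<open>openin X (\<Union>\<W>)\<close>] unfolding hereditarily_def by blast
  then obtain \<U> where \<U>: "countable \<U>" "\<U> \<subseteq> \<W>" "\<Union>\<W> \<subseteq> \<Union>\<U>"
    using Lindelof_space_subtopology_subset[OF openin_subset[OF \<open>openin X (\<Union>\<W>)\<close>]]
    by (metis (no_types, lifting) \<W>_def mem_Collect_eq order_refl)
  have "\<exists>\<V>. countable \<V> \<and> \<V> \<subseteq> good \<and> W \<subseteq> \<Union>\<V>" if "W \<in> \<W>" for W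
    using that by (simp add: \<W>_def)
  then obtain c where c: "\<And>W. W \<in> \<W> \<Longrightarrow> countable (c W) \<and> c W \<subseteq> good \<and> W \<subseteq> \<Union>(c W)"
    by metis
  define \<V> where "\<V> = (\<Union>W\<in>\<U>. c W)"
  have \<V>: "countable \<V>" "\<V> \<subseteq> good" "\<Union>\<W> \<subseteq> \<Union>\<V>"
    using \<U> c unfolding \<V>_def by (blast, blast, blast)
  define F where "F = topspace X - \<Union>\<W>"
  have F: "closedin X F"
    using \<open>openin X (\<Union>\<W>)\<close> by (auto simp: F_def)
  have "F = {}"
  proof (rule ccontr)
    assume "F \<noteq> {}"
    have "Lindelof_space (subtopology X F)"
      using assms(1) unfolding hereditarily_def F_def by blast
    moreover have "has_sigma_discrete_pi_base (subtopology X F)"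
      using assms(3) F unfolding closed_hereditarily_def by blast
    ultimately obtain \<B> where "countable \<B>" "pi_base (subtopology X F) \<B>"
      using countable_pi_base by blast
    moreover have "Baire_space (subtopology X F)"
      using assms(2) F unfolding closed_hereditarily_def by blast
    ultimately obtain B where B: "openin (subtopology X F) B" "B \<noteq> {}"
      "bounded (f ` (E \<inter> zero_hull X B))"
      using bounded_hull_of_relatively_open[OF E f F \<open>F \<noteq> {}\<close>] by blast
    \<comment> \<open>Adding \<open>B\<close> to \<open>\<V>\<close> covers \<open>W\<close>, since
      \<open>W - F\<close> lies in \<open>\<Union>\<W>\<close>. Then \<open>W\<close> belongs to
      \<open>\<W>\<close> and cannot meet \<open>F\<close>.\<close>
    obtain W where W: "openin X W" "B = W \<inter> F"
      using B(1) by (auto simp: openin_subtopology)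
    have "B \<in> good"
      using B(3) W openin_subset[OF W(1)] by (auto simp: good_def)
    moreover have "W \<subseteq> \<Union>(insert B \<V>)"
      using W openin_subset[OF W(1)] \<V>(3) by (auto simp: F_def)
    ultimately have "W \<in> \<W>"
      unfolding \<W>_def mem_Collect_eq using W(1) \<V>(1,2)
      by (intro conjI exI[of _ "insert B \<V>"]) auto
    then show False
      using W(2) B(2) by (auto simp: F_def)
  qed
  then have cover: "topspace X \<subseteq> \<Union>\<V>"
    using \<V>(3) by (auto simp: F_def)
  show "\<exists>g. Baire_one X g \<and> (\<forall>x\<in>E. g x = f x)"
  \<comment> \<open>A nonempty \<open>E\<close> makes \<open>\<V>\<close> nonempty, so that it can
    be enumerated.\<close>
  proof (cases "E = {}")
    case True
    have "Baire_one X (\<lambda>_. 0)"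
      unfolding Baire_one_def by (intro exI[of _ "\<lambda>_ _. 0"]) auto
    then show ?thesis
      using True by blast
  next
    case False
    then have "\<V> \<noteq> {}"
      using cover EX by blast
    define V where "V = from_nat_into \<V>"
    have range_V: "range V = \<V>"
      unfolding V_def using \<open>\<V> \<noteq> {}\<close> \<V>(1) by (rule range_from_nat_into)
    have V: "V n \<in> good" for n
      using range_V \<V>(2) by blast
    have "\<exists>M>0. \<forall>x \<in> E \<inter> zero_hull X (V n). \<bar>f x\<bar> \<le> M" for n
      using V[of n] by (auto simp: good_def bounded_pos)
    then obtain M where M: "\<And>n. 0 < M n" "\<And>n x. x \<in> E \<inter> zero_hull X (V n) \<Longrightarrow> \<bar>f x\<bar> \<le> M n"
      by metis
    have "topspace X \<subseteq> (\<Union>n. zero_hull X (V n))"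
    proof
      fix x assume "x \<in> topspace X"
      then obtain n where "x \<in> V n"
        using cover range_V by blast
      moreover have "V n \<subseteq> topspace X"
        using V[of n] by (simp add: good_def)
      ultimately show "x \<in> (\<Union>n. zero_hull X (V n))"
        using subset_zero_hull by blast
    qed
    then obtain b where b: "Baire_one X b"
      "\<And>x. x \<in> topspace X \<Longrightarrow> \<exists>n. x \<in> zero_hull X (V n) \<and> M n \<le> b x"
      using Baire_one_dominating[OF assms(1), of V M] M(1) less_imp_le by blast
    \<comment> \<open>Some hull containing \<open>x\<close> has its bound \<open>M n\<close> below
      \<open>b x\<close>, and \<open>M n\<close> bounds \<open>\<bar>f\<bar>\<close> on that hull
      within \<open>E\<close>.\<close>
    have "\<bar>f x\<bar> \<le> b x" if "x \<in> E" for x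
      using b(2)[of x] M(2)[of x] EX that by fastforce
    moreover have "Baire_one (subtopology X E) (\<lambda>x. arctan (f x))"
      by (rule Baire_one_compose[OF f]) (intro continuous_intros)
    moreover have "bounded ((\<lambda>x. arctan (f x)) ` E)"
      by (rule bounded_subset[OF bounded_closed_interval[of "- (pi/2)" "pi/2"]])
        (use arctan_bounded in \<open>force intro: less_imp_le\<close>)
    ultimately show ?thesis
      using E b(1) Baire_one_extension_of_dominated[of X _ E f b]
      unfolding B1_star_embedded_def by blast
  qed
qed

end
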